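(* Let $n\ge 3$. Then $h(n,k)=n$ if $k=1$; $h(n,k)=\sum_{i=n-k}^{n-1}\binom{n}{i}-1$ if $1<k<n$; $h(n,k)=2^n-4$ if $n\le k\le \binom{n-2}{\lfloor n/2\rfloor-1}+1$.
   Context: An antichain in $2^{[n]}$ (where $[n]=\{1,\dots,n\}$) is a family of subsets of $[n]$ none of which is contained in another. For a family $\mathcal{S}$ of subsets of $[n]$ and a query set $Q\subseteq[n]$, the answer to $Q$ is YES if $Q\supseteq S$ for at least one $S\in\mathcal{S}$, and NO otherwise. $h(n,k)$ denotes the smallest size of a family $\mathcal{G}\subseteq 2^{[n]}$ such that for any two distinct antichains $\mathcal{H},\mathcal{H}'$ in $2^{[n]}$ with $|\mathcal{H}|=|\mathcal{H}'|=k$ there is $G\in\mathcal{G}$ whose answer differs for $\mathcal{H}$ and $\mathcal{H}'$, i.e. $G$ contains a member of one of them but no member of the other. *)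

theory Defs
  imports Complex_Main
begin

definition antichain_on :: "'a set \<Rightarrow> 'a set set \<Rightarrow> bool" where
  "antichain_on V H \<longleftrightarrow> H \<subseteq> Pow V \<and> (\<forall>A\<in>H. \<forall>B\<in>H. A \<noteq> B \<longrightarrow> \<not> A \<subseteq> B)"

definition answer :: "'a set set \<Rightarrow> 'a set \<Rightarrow> bool" where
  "answer S Q \<longleftrightarrow> (\<exists>A\<in>S. A \<subseteq> Q)"

definition separates_antichains :: "nat \<Rightarrow> nat \<Rightarrow> nat set set \<Rightarrow> bool" where
  "separates_antichains n k \<G> \<longleftrightarrow>
     (\<forall>H H'. antichain_on {1..n} H \<and> antichain_on {1..n} H' \<and> card H = k \<and> card H' = k \<and> H \<noteq> H'
        \<longrightarrow> (\<exists>G\<in>\<G>. answer H G \<noteq> answer H' G))"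

(* The minimum is over a nonempty set: an antichain is determined by the up-set it generates,
   so the full power set of {1..n} always separates. *)
definition h :: "nat \<Rightarrow> nat \<Rightarrow> nat" where
  "h n k = (LEAST m. \<exists>\<G>. \<G> \<subseteq> Pow {1..n} \<and> separates_antichains n k \<G> \<and> card \<G> = m)"

end

theory Submission
  imports Defs
begin

text \<open>
  An antichain is determined by the up-set it generates, and a query tests membership in that
  up-set. Let \<open>k > 1\<close>. Lower bounds: two antichains of size \<open>k\<close> whose up-sets differ only inside a family
  \<open>X\<close> force every separating family to meet \<open>X\<close>. Such pairs exist with \<open>X\<close> a single set
  for every set of size between \<open>n - k\<close> (for \<open>k \<ge> n\<close>: between 2) and \<open>n - 2\<close>, with \<open>X\<close>
  consisting of any two complements of singletons, and, for \<open>k \<ge> n\<close>, of any two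
  singletons. So at most one complement of a singleton, and for \<open>k \<ge> n\<close> at most one singleton,
  can be omitted. Upper bounds: if \<open>S\<close> contains none of the \<open>k\<close> members of \<open>H'\<close>, removing
  one suitable point per member yields a superset of \<open>S\<close> of size at least \<open>n - k\<close> with the
  same property; analysing when this fails to avoid the omitted sets shows that omitting them is
  harmless.
\<close>

section \<open>Forced queries and elementary antichains\<close>

text \<open>\<open>X\<close> is a set of queries because some constructions force no single query:
  for complements of singletons, and for singletons when \<open>n \<le> k\<close>, they only show
  that one of two given queries must be present.\<close>

definition critical_pair :: "'a set \<Rightarrow> nat \<Rightarrow> 'a set set \<Rightarrow> bool" where
  "critical_pair V k X \<longleftrightarrow> (\<exists>H H'. antichain_on V H \<and> antichain_on V H' \<and> card H = k \<and> card H' = k \<and> H \<noteq> H'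
      \<and> (\<forall>Q. Q \<subseteq> V \<and> answer H Q \<noteq> answer H' Q \<longrightarrow> Q \<in> X))"

lemma separates_meets_critical_pair:
  assumes "separates_antichains n k \<G>" "\<G> \<subseteq> Pow {1..n}" "critical_pair {1..n} k X"
  shows "\<exists>G\<in>X. G \<in> \<G>"
proof -
  obtain H H' where H: "antichain_on {1..n} H" "antichain_on {1..n} H'" "card H = k" "card H' = k" "H \<noteq> H'"
    and d: "\<And>Q. Q \<subseteq> {1..n} \<Longrightarrow> answer H Q \<noteq> answer H' Q \<Longrightarrow> Q \<in> X"
    using assms(3) unfolding critical_pair_def by blast
  obtain G where "G \<in> \<G>" "answer H G \<noteq> answer H' G"
    using assms(1) H unfolding separates_antichains_def by blast
  then show ?thesis using d assms(2) by blast
qed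

lemma h_eqI:
  assumes "\<G> \<subseteq> Pow {1..n}" "separates_antichains n k \<G>" "card \<G> = m"
    and "\<And>\<F>. \<F> \<subseteq> Pow {1..n} \<Longrightarrow> separates_antichains n k \<F> \<Longrightarrow> m \<le> card \<F>"
  shows "h n k = m"
  unfolding h_def by (rule Least_equality) (use assms in blast)+

lemma antichain_on_singleton: "S \<subseteq> V \<Longrightarrow> antichain_on V {S}"
  by (auto simp: antichain_on_def)

lemma antichain_on_insert:
  assumes "antichain_on V F" "G \<subseteq> V" "\<And>A. A \<in> F \<Longrightarrow> \<not> A \<subseteq> G" "\<And>A. A \<in> F \<Longrightarrow> \<not> G \<subseteq> A"
  shows "antichain_on V (insert G F)"
  using assms unfolding antichain_on_def by auto

lemma antichain_onD:
  "antichain_on V H \<Longrightarrow> A \<in> H \<Longrightarrow> B \<in> H \<Longrightarrow> A \<subseteq> B \<Longrightarrow> A = B"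
  unfolding antichain_on_def by blast

lemma empty_notin_antichain:
  assumes "antichain_on V K" "2 \<le> card K"
  shows "{} \<notin> K"
proof
  assume "{} \<in> K"
  then have "K \<subseteq> {{}}" using antichain_onD[OF assms(1)] by blast
  then have "card K \<le> 1" using card_mono[of "{{}}" K] by simp
  then show False using assms(2) by simp
qed

lemma antichain_on_uniform:
  assumes "F \<subseteq> {B. B \<subseteq> V \<and> card B = m}" "finite V"
  shows "antichain_on V F"
  unfolding antichain_on_def
proof (intro conjI ballI impI notI)
  show "F \<subseteq> Pow V" using assms by auto
  fix A B assume "A \<in> F" "B \<in> F" "A \<noteq> B" "A \<subseteq> B"
  moreover have "finite B" "card A = card B" using \<open>A \<in> F\<close> \<open>B \<in> F\<close> assms by (auto intro: finite_subset)
  ultimately show False using card_subset_eq by blast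
qed

lemma antichain_on_image_Un:
  assumes "antichain_on W T" "W \<inter> X = {}" "W \<union> X \<subseteq> V"
  shows "antichain_on V ((\<lambda>B. X \<union> B) ` T)" "card ((\<lambda>B. X \<union> B) ` T) = card T"
proof -
  have T: "B \<inter> X = {}" "B \<subseteq> W" if "B \<in> T" for B using that assms unfolding antichain_on_def by blast+
  have le: "B \<subseteq> B'" if "B \<in> T" "B' \<in> T" "X \<union> B \<subseteq> X \<union> B'" for B B' using that T(1)[OF that(1)] by blast
  show "antichain_on V ((\<lambda>B. X \<union> B) ` T)"
    unfolding antichain_on_def
  proof (intro conjI ballI impI notI)
    show "(\<lambda>B. X \<union> B) ` T \<subseteq> Pow V" using T(2) assms(3) by blast
    fix A A' assume "A \<in> (\<lambda>B. X \<union> B) ` T" "A' \<in> (\<lambda>B. X \<union> B) ` T" "A \<noteq> A'" "A \<subseteq> A'"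
    then obtain B B' where "B \<in> T" "B' \<in> T" "A = X \<union> B" "A' = X \<union> B'" by blast
    then show False using le[of B B'] antichain_onD[OF assms(1), of B B'] \<open>A \<noteq> A'\<close> \<open>A \<subseteq> A'\<close> by blast
  qed
  have "inj_on (\<lambda>B. X \<union> B) T"
    using le by (intro inj_onI subset_antisym) auto
  then show "card ((\<lambda>B. X \<union> B) ` T) = card T" by (rule card_image)
qed

lemma card_Diff_pair:
  assumes "finite V" "i \<in> V" "j \<in> V" "i \<noteq> j"
  shows "card (V - {i, j}) + 2 = card V"
proof -
  have "card {i, j} \<le> card V" by (rule card_mono) (use assms in auto)
  then show ?thesis using card_Diff_subset[of "{i, j}" V] assms by simp
qed

text \<open>Singletons serve for \<open>j \<ge> 2\<close>. The case \<open>j = 1\<close> uses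
  \<open>{{}}\<close> instead, since for a one-point \<open>V\<close> the singleton is
  \<open>V\<close> itself.\<close>

lemma small_antichain_exists:
  assumes "finite V" "1 \<le> j" "j \<le> card V"
  obtains T where "antichain_on V T" "card T = j" "V \<notin> T"
proof (cases "j = 1")
  case True
  have "antichain_on V {{}}" by (rule antichain_on_singleton) simp
  moreover have "V \<noteq> {}" using assms by auto
  ultimately show ?thesis using that[of "{{}}"] True by auto
next
  case False
  have "card {B. B \<subseteq> V \<and> card B = 1} = card V"
    using n_subsets[OF assms(1), of 1] by simp
  then have "j \<le> card {B. B \<subseteq> V \<and> card B = 1}" using assms(3) by simp
  then obtain T where T: "T \<subseteq> {B. B \<subseteq> V \<and> card B = 1}" "card T = j"
    by (rule obtain_subset_with_card_n)
  show ?thesis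
  proof (rule that[OF _ T(2)])
    show "antichain_on V T" using antichain_on_uniform[OF T(1) assms(1)] .
    have "card V \<noteq> 1" using assms(2,3) False by simp
    then show "V \<notin> T" using T(1) by blast
  qed
qed

section \<open>Constructions of critical pairs (lower bounds)\<close>

text \<open>Extend \<open>F\<close> by \<open>G\<close> or by \<open>insert x0 G\<close>. A query
  \<open>Q\<close> telling these apart contains \<open>G\<close>, omits \<open>x0\<close> and
  contains no member of \<open>F\<close>. Any further point \<open>x\<close> of \<open>Q\<close>
  would bring in the member of \<open>F\<close> inside \<open>insert x G\<close>, so
  \<open>Q = G\<close>. The conditions \<open>nsub\<close> and \<open>nsup\<close> keep both
  extensions antichains.\<close>

lemma critical_pair_forced_set:
  assumes "finite V" "G \<subseteq> V" "x0 \<in> V - G" and F: "antichain_on V F" "card F + 1 = k"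
    and nsub: "\<And>A. A \<in> F \<Longrightarrow> \<not> A \<subseteq> insert x0 G"
    and nsup: "\<And>A. A \<in> F \<Longrightarrow> \<not> G \<subseteq> A"
    and cover: "\<And>x. x \<in> V - G \<Longrightarrow> x \<noteq> x0 \<Longrightarrow> \<exists>A\<in>F. A \<subseteq> insert x G"
  shows "critical_pair V k {G}"
proof -
  have "F \<subseteq> Pow V" using F unfolding antichain_on_def by blast
  then have fin: "finite F" by (rule finite_subset) (simp add: assms(1))
  have notin: "G \<notin> F" "insert x0 G \<notin> F" using nsub by blast+
  show ?thesis unfolding critical_pair_def
  proof (intro exI conjI allI impI)
    show "antichain_on V (insert G F)"
      by (rule antichain_on_insert[OF F(1) assms(2)]) (use nsub nsup in blast)+
    have "insert x0 G \<subseteq> V" using assms(2,3) by blast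
    then show "antichain_on V (insert (insert x0 G) F)"
      by (rule antichain_on_insert[OF F(1)]) (use nsub nsup in blast)+
    show "card (insert G F) = k" "card (insert (insert x0 G) F) = k"
      using fin notin F(2) by auto
    have "G \<noteq> insert x0 G" using assms(3) by blast
    then show "insert G F \<noteq> insert (insert x0 G) F" using notin by blast
    fix Q assume Q: "Q \<subseteq> V \<and> answer (insert G F) Q \<noteq> answer (insert (insert x0 G) F) Q"
    then have GQ: "G \<subseteq> Q" and x0: "x0 \<notin> Q" and nF: "\<And>A. A \<in> F \<Longrightarrow> \<not> A \<subseteq> Q"
      unfolding answer_def by auto
    have "x \<in> G" if xQ: "x \<in> Q" for x
    proof (rule ccontr)
      assume "x \<notin> G"
      then obtain A where "A \<in> F" "A \<subseteq> insert x G" using cover[of x] xQ x0 Q by blast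
      then show False using nF GQ xQ by blast
    qed
    then show "Q \<in> {G}" using GQ by blast
  qed
qed

text \<open>Put \<open>{i, j}\<close> into every member of \<open>T\<close> and add either
  \<open>V - {i}\<close> or \<open>V - {j}\<close>. A query telling the results apart contains
  exactly one of these two complements, so it is not \<open>V\<close> and equals that
  complement.\<close>

lemma critical_pair_cosingletons:
  assumes "finite V" "i \<in> V" "j \<in> V" "i \<noteq> j"
    and T: "antichain_on (V - {i, j}) T" "V - {i, j} \<notin> T" "card T + 1 = k"
  shows "critical_pair V k {V - {i}, V - {j}}"
proof -
  define F where "F = (\<lambda>B. {i, j} \<union> B) ` T"
  have F: "antichain_on V F" "card F = card T"
    unfolding F_def by (rule antichain_on_image_Un[OF T(1)]; use assms in blast)+
  have TP: "B \<subset> V - {i, j}" if "B \<in> T" for B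
    using T(1,2) that unfolding antichain_on_def by blast
  have FP: "i \<in> A" "j \<in> A" "A \<subset> V" if "A \<in> F" for A
    using that TP assms(2,3) unfolding F_def by blast+
  have fin: "finite F"
    using FP(3) assms(1) by (intro finite_subset[of F "Pow V"]) auto
  show ?thesis unfolding critical_pair_def
  proof (intro exI conjI allI impI)
    show "antichain_on V (insert (V - {i}) F)"
      by (rule antichain_on_insert[OF F(1)]) (use FP assms in blast)+
    show "antichain_on V (insert (V - {j}) F)"
      by (rule antichain_on_insert[OF F(1)]) (use FP assms in blast)+
    have "V - {i} \<notin> F" "V - {j} \<notin> F" using FP by blast+
    then show "card (insert (V - {i}) F) = k" "card (insert (V - {j}) F) = k"
      "insert (V - {i}) F \<noteq> insert (V - {j}) F"
      using fin F(2) T(3) assms by auto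
    fix Q assume Q: "Q \<subseteq> V \<and> answer (insert (V - {i}) F) Q \<noteq> answer (insert (V - {j}) F) Q"
    then have "V - {i} \<subseteq> Q \<or> V - {j} \<subseteq> Q" "\<not> (V - {i} \<subseteq> Q \<and> V - {j} \<subseteq> Q)"
      unfolding answer_def by auto
    then show "Q \<in> {V - {i}, V - {j}}" using Q assms by blast
  qed
qed

text \<open>The two antichains are \<open>K a b\<close> and \<open>K b a\<close>. Both answer YES as
  soon as a query contains \<open>a\<close> or \<open>b\<close> together with any further point, and
  they agree on queries inside \<open>W\<close>; only \<open>{a}\<close> and \<open>{b}\<close>
  remain. The size is \<open>1 + (card V - 2) + card F\<close>.\<close>

lemma critical_pair_singletons:
  assumes "finite V" "a \<in> V" "b \<in> V" "a \<noteq> b"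
    and F: "antichain_on (V - {a, b}) F" "\<And>A. A \<in> F \<Longrightarrow> 2 \<le> card A" "card F + card V = k + 1"
  shows "critical_pair V k {{a}, {b}}"
proof -
  define W where "W = V - {a, b}"
  define K where "K c d = insert {c} ((\<lambda>y. {d, y}) ` W \<union> F)" for c d
  have FP: "A \<subseteq> W" if "A \<in> F" for A
    using F(1) that unfolding antichain_on_def W_def by blast
  have big: "\<not> A \<subseteq> {y}" if "A \<in> F" for A y
    using F(2)[OF that] card_mono[of "{y}" A] by auto
  have finF: "finite F" using FP assms(1) by (intro finite_subset[of F "Pow V"]) (auto simp: W_def)
  have finW: "finite W" "card W + 2 = card V"
    using assms(1) card_Diff_pair[OF assms(1-4)] by (auto simp: W_def)
  have anti: "antichain_on V (K c d)" and card: "card (K c d) = k"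
    if cd: "{c, d} = {a, b}" "c \<noteq> d" for c d
  proof -
    have cd': "c \<in> V" "d \<in> V" "c \<notin> W" "d \<notin> W" using cd assms by (auto simp: W_def doubleton_eq_iff)
    show "antichain_on V (K c d)" unfolding K_def
    proof (rule antichain_on_insert)
      show "{c} \<subseteq> V" using cd' by blast
      show "antichain_on V ((\<lambda>y. {d, y}) ` W \<union> F)"
        unfolding antichain_on_def
      proof (intro conjI ballI impI notI)
        show "(\<lambda>y. {d, y}) ` W \<union> F \<subseteq> Pow V" using cd' FP by (auto simp: W_def)
        fix A B assume A: "A \<in> (\<lambda>y. {d, y}) ` W \<union> F" and B: "B \<in> (\<lambda>y. {d, y}) ` W \<union> F"
          and AB: "A \<noteq> B" "A \<subseteq> B"
        show False
        proof (cases "A \<in> F")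
          case True
          show ?thesis
          proof (cases "B \<in> F")
            case True
            then show ?thesis using antichain_onD[OF F(1) \<open>A \<in> F\<close>] AB by blast
          next
            case False
            then obtain y where "B = {d, y}" using B by blast
            then have "A \<subseteq> {y}" using AB FP[OF \<open>A \<in> F\<close>] cd' by blast
            then show ?thesis using big[OF True] by blast
          qed
        next
          case False
          then obtain y where y: "A = {d, y}" "y \<in> W" using A by blast
          show ?thesis
          proof (cases "B \<in> F")
            case True
            then show ?thesis using FP[OF True] AB y cd' by blast
          next
            case False
            then show ?thesis using B y AB cd' by auto
          qed
        qed
      qed
      show "\<not> A \<subseteq> {c}" if "A \<in> (\<lambda>y. {d, y}) ` W \<union> F" for A using that big cd by auto
      show "\<not> {c} \<subseteq> A" if "A \<in> (\<lambda>y. {d, y}) ` W \<union> F" for A using that FP cd cd' by auto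
    qed
    have "inj_on (\<lambda>y. {d, y}) W" by (auto simp: inj_on_def doubleton_eq_iff)
    then have 1: "card ((\<lambda>y. {d, y}) ` W) = card W" by (rule card_image)
    have 2: "(\<lambda>y. {d, y}) ` W \<inter> F = {}" using FP cd' by blast
    have "{c} \<notin> (\<lambda>y. {d, y}) ` W \<union> F" using FP cd cd' by blast
    then show "card (K c d) = k" unfolding K_def using 1 2 finW finF F(3)
      by (simp add: card_Un_disjoint)
  qed
  have ans: "answer (K c d) Q \<longleftrightarrow> answer F Q \<or> c \<in> Q \<or> d \<in> Q \<and> W \<inter> Q \<noteq> {}" for c d Q
    unfolding K_def answer_def by (auto simp: bex_Un)
  show ?thesis unfolding critical_pair_def
  proof (intro exI conjI allI impI)
    show "antichain_on V (K a b)" "card (K a b) = k" using anti card assms(4) by blast+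
    show "antichain_on V (K b a)" "card (K b a) = k" using anti card assms(4) by blast+
    have "answer (K a b) {a}" "\<not> answer (K b a) {a}"
      using assms(4) big unfolding ans by (auto simp: W_def answer_def)
    then show "K a b \<noteq> K b a" by auto
    fix Q assume Q: "Q \<subseteq> V \<and> answer (K a b) Q \<noteq> answer (K b a) Q"
    have "Q \<subseteq> W \<union> {a, b}" using Q by (auto simp: W_def)
    then show "Q \<in> {{a}, {b}}" using Q unfolding ans by blast
  qed
qed

text \<open>Points outside \<open>G\<close> other than \<open>x0\<close> and \<open>x1\<close> are
  covered by their own singletons, and \<open>x1\<close> by sets \<open>insert x1 B\<close> with
  \<open>B\<close> a proper subset of \<open>G\<close>. The number of such \<open>B\<close> is
  chosen to bring the total to \<open>k - 1\<close>; it lies between 1 and \<open>card G\<close>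
  exactly because \<open>card V \<le> card G + k\<close> and \<open>k < card V\<close>.\<close>

lemma critical_pair_few:
  assumes "finite V" "G \<subseteq> V" "G \<noteq> {}" "card G + 2 \<le> card V" "card V \<le> card G + k" "k < card V"
  shows "critical_pair V k {G}"
proof -
  have finG: "finite G" using assms finite_subset by blast
  have c: "card (V - G) = card V - card G" using card_Diff_subset[OF finG assms(2)] .
  then have "2 \<le> card (V - G)" using assms by simp
  then obtain X where X: "X \<subseteq> V - G" "card X = 2" by (rule obtain_subset_with_card_n)
  then obtain x0 x1 where x: "x0 \<in> V - G" "x1 \<in> V - G" "x0 \<noteq> x1" by (auto simp: card_2_iff)
  obtain T where T: "antichain_on G T" "card T = k + card G + 1 - card V" "G \<notin> T"
    by (rule small_antichain_exists[OF finG, of "k + card G + 1 - card V"]) (use assms in auto)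
  define C where "C = V - G - {x0, x1}"
  define P where "P = (\<lambda>B. {x1} \<union> B) ` T"
  define F where "F = (\<lambda>x. {x}) ` C \<union> P"
  have TP: "B \<subset> G" if "B \<in> T" for B using T that unfolding antichain_on_def by blast
  have P: "antichain_on V P" "card P = card T"
    unfolding P_def by (rule antichain_on_image_Un[OF T(1)]; use x assms in blast)+
  have PP: "x1 \<in> A" "A \<subseteq> insert x1 G" "\<not> G \<subseteq> A" if "A \<in> P" for A
    using that TP x(2) unfolding P_def by blast+
  have PV: "P \<subseteq> Pow V" using P(1) unfolding antichain_on_def by blast
  then have finP: "finite P" by (rule finite_subset) (simp add: assms(1))
  have cardC: "card C + 2 = card (V - G)"
    unfolding C_def by (rule card_Diff_pair) (use x assms(1) in auto)
  have C: "x \<noteq> x0" "x \<noteq> x1" "x \<in> V" "x \<notin> G" if "x \<in> C" for x using that by (auto simp: C_def)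
  have Tne: "T \<noteq> {}" using T(2) assms by auto
  show ?thesis
  proof (rule critical_pair_forced_set[OF assms(1,2) x(1)])
    show "antichain_on V F" unfolding antichain_on_def
    proof (intro conjI ballI impI notI)
      show "F \<subseteq> Pow V" using PV C(3) unfolding F_def by blast
      fix A B assume AB: "A \<in> F" "B \<in> F" "A \<noteq> B" "A \<subseteq> B"
      have *: "\<not> {x} \<subseteq> K" "\<not> K \<subseteq> {x}" if "x \<in> C" "K \<in> P" for x K
        using PP(1,2)[OF that(2)] C[OF that(1)] by blast+
      show False
        using AB antichain_onD[OF P(1), of A B] * unfolding F_def by (elim UnE imageE) auto
    qed
    have "(\<lambda>x. {x}) ` C \<inter> P = {}" using PP(1) C(2) by blast
    moreover have "card ((\<lambda>x. {x}) ` C) = card C" by (rule card_image) simp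
    ultimately have "card F = card C + card P"
      unfolding F_def using finP assms(1) by (simp add: card_Un_disjoint C_def)
    then show "card F + 1 = k" using cardC c P(2) T(2) assms by simp
    show "\<not> A \<subseteq> insert x0 G" if "A \<in> F" for A
      using that PP(1) C(1,4) x(2,3) unfolding F_def by (elim UnE imageE) auto
    show "\<not> G \<subseteq> A" if "A \<in> F" for A
      using that PP(3) C(4) assms(3) unfolding F_def by (elim UnE imageE) auto
    show "\<exists>A\<in>F. A \<subseteq> insert x G" if "x \<in> V - G" "x \<noteq> x0" for x
    proof (cases "x = x1")
      case True
      then show ?thesis using Tne PP(2) unfolding F_def P_def by blast
    next
      case False
      then have "{x} \<in> F" using that by (auto simp: F_def C_def)
      then show ?thesis by blast
    qed
  qed
qed

text \<open>Separates covering from counting: a small \<open>R\<close> already covers, a large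
  antichain \<open>W\<close> supplies enough members, and any family of size \<open>k - 1\<close>
  between them works.\<close>

lemma critical_pair_between:
  assumes "finite V" "G \<subseteq> V" "x0 \<in> V - G" and W: "antichain_on V W"
    and R: "R \<subseteq> W" "card R < k" "k \<le> card W + 1"
    and nsub: "\<And>A. A \<in> W \<Longrightarrow> \<not> A \<subseteq> insert x0 G"
    and nsup: "\<And>A. A \<in> W \<Longrightarrow> \<not> G \<subseteq> A"
    and cover: "\<And>x. x \<in> V - G \<Longrightarrow> x \<noteq> x0 \<Longrightarrow> \<exists>A\<in>R. A \<subseteq> insert x G"
  shows "critical_pair V k {G}"
proof -
  have "W \<subseteq> Pow V" using W unfolding antichain_on_def by blast
  then have "finite W" by (rule finite_subset) (simp add: assms(1))
  moreover have "card R \<le> k - 1" "k - 1 \<le> card W" using R by auto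
  ultimately obtain F where F: "R \<subseteq> F" "F \<subseteq> W" "card F = k - 1"
    using exists_subset_between[of R "k - 1" W] R(1) by blast
  show ?thesis
  proof (rule critical_pair_forced_set[OF assms(1-3)])
    show "antichain_on V F" using W F(2) unfolding antichain_on_def by blast
    show "card F + 1 = k" using F(3) R(2) by simp
    show "\<not> A \<subseteq> insert x0 G" "\<not> G \<subseteq> A" if "A \<in> F" for A using that F(2) nsub nsup by blast+
    show "\<exists>A\<in>F. A \<subseteq> insert x G" if "x \<in> V - G" "x \<noteq> x0" for x using cover[OF that] F(1) by blast
  qed
qed

text \<open>The complement of \<open>G\<close> is covered by sets \<open>insert x (G - {g})\<close>; the remaining
  members are \<open>insert x1 B\<close> with \<open>B\<close> of size \<open>m\<close> avoiding one point \<open>d\<close> of \<open>G\<close>.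
  For \<open>card G > m\<close> one takes \<open>d = g\<close>, and some \<open>B \<subseteq> G - {g}\<close> covers \<open>x1\<close>; for
  \<open>card G \<le> m\<close> one takes \<open>d \<noteq> g\<close>.\<close>

lemma critical_pair_many:
  assumes "finite V" "G \<subseteq> V" "2 \<le> card G" "card G + 2 \<le> card V"
    and k: "card V \<le> k" "k \<le> ((card V - 2) choose m) + 1"
  shows "critical_pair V k {G}"
proof -
  have finG: "finite G" using assms finite_subset by blast
  have c: "card (V - G) = card V - card G" using card_Diff_subset[OF finG assms(2)] .
  then have "2 \<le> card (V - G)" using assms by simp
  then obtain X where X: "X \<subseteq> V - G" "card X = 2" by (rule obtain_subset_with_card_n)
  then obtain x0 x1 where x: "x0 \<in> V - G" "x1 \<in> V - G" "x0 \<noteq> x1" by (auto simp: card_2_iff)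
  obtain Y where Y: "Y \<subseteq> G" "card Y = 2" using assms(3) by (rule obtain_subset_with_card_n)
  then obtain g e where g: "g \<in> G" "e \<in> G" "g \<noteq> e" by (auto simp: card_2_iff)
  \<comment> \<open>Members of \<open>P d\<close> omit \<open>d\<close> and the sets
    \<open>E x\<close> omit \<open>g\<close>, so none of them contains \<open>G\<close>.\<close>
  define P where "P d = (\<lambda>B. {x1} \<union> B) ` {B. B \<subseteq> V - {x1, d} \<and> card B = m}" for d
  define E where "E x = insert x (G - {g})" for x
  have cardE: "card (E x) = card G" if "x \<notin> G" for x
    using that finG g(1) card_Suc_Diff1[OF finG g(1)] by (simp add: E_def)
  have P: "antichain_on V (P d)" "card (P d) = (card V - 2) choose m" if "d \<in> G" for d
  proof -
    have L: "antichain_on (V - {x1, d}) {B. B \<subseteq> V - {x1, d} \<and> card B = m}"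
      by (rule antichain_on_uniform[OF subset_refl]) (use assms(1) in simp)
    have "card (V - {x1, d}) + 2 = card V"
      by (rule card_Diff_pair) (use x(2) that assms(1,2) in auto)
    then have "card {B. B \<subseteq> V - {x1, d} \<and> card B = m} = (card V - 2) choose m"
      using n_subsets[of "V - {x1, d}" m] assms(1) by (simp flip: \<open>_ = card V\<close>)
    moreover have "antichain_on V (P d)" "card (P d) = card {B. B \<subseteq> V - {x1, d} \<and> card B = m}"
      unfolding P_def by (rule antichain_on_image_Un[OF L]; use x assms that in blast)+
    ultimately show "antichain_on V (P d)" "card (P d) = (card V - 2) choose m" by simp_all
  qed
  have PP: "x1 \<in> A" "d \<notin> A" "A \<subseteq> V" "finite A" "card A = Suc m" if AP: "A \<in> P d" "d \<in> G" for A d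
  proof -
    obtain B where B: "A = insert x1 B" "B \<subseteq> V - {x1, d}" "card B = m" using AP(1) unfolding P_def by blast
    moreover have "finite B" using B assms(1) finite_subset by blast
    moreover have "x1 \<notin> B" using B by blast
    ultimately show "x1 \<in> A" "d \<notin> A" "A \<subseteq> V" "finite A" "card A = Suc m" using x that by auto
  qed
  have EE: "x = y" if "x \<in> V - G" "E x \<subseteq> E y" for x y using that by (auto simp: E_def)
  have EV: "E x \<subseteq> V" if "x \<in> V" for x using that assms(2) by (auto simp: E_def)
  have anti: "antichain_on V (P d \<union> E ` C)"
    if d: "d \<in> G" and C: "C \<subseteq> V - G" and "\<And>x A. x \<in> C \<Longrightarrow> A \<in> P d \<Longrightarrow> \<not> E x \<subseteq> A \<and> \<not> A \<subseteq> E x" for C d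
    unfolding antichain_on_def
  proof (intro conjI ballI impI notI)
    show "P d \<union> E ` C \<subseteq> Pow V" using PP(3)[OF _ d] EV C by blast
    fix A B assume A: "A \<in> P d \<union> E ` C" and B: "B \<in> P d \<union> E ` C" and AB: "A \<noteq> B" "A \<subseteq> B"
    show False
    proof (cases "A \<in> P d")
      case True
      then show ?thesis using antichain_onD[OF P(1)[OF d], of A B] B AB that(3) by blast
    next
      case False
      then obtain x where "x \<in> C" "A = E x" using A by blast
      then show ?thesis using B AB that(3) EE[of x] C by blast
    qed
  qed
  have nsub: "\<not> A \<subseteq> insert x0 G" if "A \<in> P d \<union> E ` C" "d \<in> G" "C \<subseteq> V - G - {x0}" for A d C
  proof (cases "A \<in> P d")
    case True
    then show ?thesis using PP(1)[OF True that(2)] x by blast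
  next
    case False
    then show ?thesis using that by (auto simp: E_def)
  qed
  have nsup: "\<not> G \<subseteq> A" if "A \<in> P d \<union> E ` C" "d \<in> G" "C \<subseteq> V - G - {x0}" for A d C
  proof (cases "A \<in> P d")
    case True
    then show ?thesis using PP(2)[OF True that(2)] that by blast
  next
    case False
    then show ?thesis using that g by (auto simp: E_def)
  qed
  have large: "k \<le> card (P d \<union> E ` C) + 1" if "d \<in> G" "C \<subseteq> V" for d C
  proof -
    have "P d \<union> E ` C \<subseteq> Pow V" using PP(3)[OF _ that(1)] EV that(2) by blast
    then have "finite (P d \<union> E ` C)" by (rule finite_subset) (simp add: assms(1))
    then have "card (P d) \<le> card (P d \<union> E ` C)" by (intro card_mono) auto
    then show ?thesis using P(2)[OF that(1)] k by simp
  qed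
  have cC: "card (E ` C) + card G \<le> card V" if "C \<subseteq> V - G" for C
  proof -
    have "card (E ` C) \<le> card C" using that assms(1) by (intro card_image_le) (auto intro: finite_subset)
    also have "\<dots> \<le> card (V - G)" using that assms(1) by (intro card_mono) auto
    finally show ?thesis using c assms by simp
  qed
  show ?thesis
  proof (cases "m < card G")
    case True
    \<comment> \<open>\<open>x1\<close> is left out because \<open>E x1\<close> would contain the
      member \<open>insert x1 B\<close> of \<open>P g\<close>; that member covers \<open>x1\<close>
      instead. For the other \<open>y\<close>, \<open>E y\<close> has at least \<open>m + 1\<close>
      points, so it lies in a member of \<open>P g\<close> only if equal to it, which
      \<open>x1\<close> rules out.\<close>
    define C where "C = V - G - {x0, x1}"
    have C: "C \<subseteq> V - G - {x0}" "C \<subseteq> V" "C \<subseteq> V - G" by (auto simp: C_def)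
    have "m \<le> card (G - {g})" using True finG g(1) by simp
    then obtain B where B: "B \<subseteq> G - {g}" "card B = m" by (rule obtain_subset_with_card_n)
    have BP: "insert x1 B \<in> P g" using B assms(2) x by (auto simp: P_def)
    show ?thesis
    proof (rule critical_pair_between[OF assms(1,2) x(1)])
      show "antichain_on V (P g \<union> E ` C)"
      proof (rule anti[OF g(1) C(3)])
        fix y A assume y: "y \<in> C" and A: "A \<in> P g"
        have x1: "x1 \<in> A" "x1 \<notin> E y" using PP(1)[OF A g(1)] x y by (auto simp: E_def C_def)
        have "E y = A" if "E y \<subseteq> A"
          using that PP(4,5)[OF A g(1)] cardE[of y] y True card_mono[of A "E y"] by (intro card_subset_eq) (auto simp: C_def)
        then show "\<not> E y \<subseteq> A \<and> \<not> A \<subseteq> E y" using x1 by blast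
      qed
      show "insert (insert x1 B) (E ` C) \<subseteq> P g \<union> E ` C" using BP by blast
      show "card (insert (insert x1 B) (E ` C)) < k"
        using cC[OF C(3)] card_insert_le_m1[of "Suc (card (E ` C))" "E ` C" "insert x1 B"] assms by simp
      show "k \<le> card (P g \<union> E ` C) + 1" by (rule large[OF g(1) C(2)])
      show "\<exists>A\<in>insert (insert x1 B) (E ` C). A \<subseteq> insert y G" if "y \<in> V - G" "y \<noteq> x0" for y
        using that B by (cases "y = x1") (auto simp: E_def C_def)
    qed (use nsub[OF _ g(1) C(1)] nsup[OF _ g(1) C(1)] in blast)+
  next
    case False
    \<comment> \<open>Here \<open>x1\<close> can stay: members of \<open>P e\<close> have more
      points than \<open>E y\<close>, and they omit \<open>e\<close>, which lies in every
      \<open>E y\<close>.\<close>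
    define C where "C = V - G - {x0}"
    have C: "C \<subseteq> V - G - {x0}" "C \<subseteq> V" "C \<subseteq> V - G" by (auto simp: C_def)
    show ?thesis
    proof (rule critical_pair_between[OF assms(1,2) x(1)])
      show "antichain_on V (P e \<union> E ` C)"
      proof (rule anti[OF g(2) C(3)])
        fix y A assume y: "y \<in> C" and A: "A \<in> P e"
        have "\<not> E y \<subseteq> A" using PP(2)[OF A g(2)] g by (auto simp: E_def)
        moreover have "\<not> A \<subseteq> E y"
          using card_mono[of "E y" A] PP(5)[OF A g(2)] cardE[of y] y False finG by (auto simp: C_def E_def)
        ultimately show "\<not> E y \<subseteq> A \<and> \<not> A \<subseteq> E y" by blast
      qed
      show "E ` C \<subseteq> P e \<union> E ` C" by blast
      show "card (E ` C) < k" using cC[OF C(3)] assms by simp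
      show "k \<le> card (P e \<union> E ` C) + 1" by (rule large[OF g(2) C(2)])
      show "\<exists>A\<in>E ` C. A \<subseteq> insert y G" if "y \<in> V - G" "y \<noteq> x0" for y
        using that by (auto simp: E_def C_def)
    qed (use nsub[OF _ g(2) C(1)] nsup[OF _ g(2) C(1)] in blast)+
  qed
qed

section \<open>Distinguishing queries (upper bounds)\<close>

text \<open>If each member of either family contained a member of the other, going down twice from a
  member would return to it by the antichain property, making the families equal.\<close>

lemma answer_antichain_inj:
  assumes "antichain_on V H" "antichain_on V H'" "H \<noteq> H'"
  shows "(\<exists>S\<in>H. \<not> answer H' S) \<or> (\<exists>S\<in>H'. \<not> answer H S)"
proof (rule ccontr)
  assume "\<not> ?thesis"
  then have a: "\<And>S. S \<in> H \<Longrightarrow> \<exists>A\<in>H'. A \<subseteq> S" "\<And>S. S \<in> H' \<Longrightarrow> \<exists>A\<in>H. A \<subseteq> S"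
    unfolding answer_def by blast+
  have "S \<in> H'" if "S \<in> H" for S
    using a(1)[OF that] a(2) antichain_onD[OF assms(1) _ that] by (metis subset_antisym subset_trans)
  moreover have "S \<in> H" if "S \<in> H'" for S
    using a(2)[OF that] a(1) antichain_onD[OF assms(2) _ that] by (metis subset_antisym subset_trans)
  ultimately show False using assms(3) by blast
qed

text \<open>If \<open>S\<close> contains no member of \<open>H\<close>, pick one point of \<open>A - S\<close> for each
  \<open>A \<in> H\<close>: the complement of these points contains \<open>S\<close> and still no member of \<open>H\<close>.
  One of the picked points may be prescribed.\<close>

lemma answer_no_extend:
  assumes "finite V" "H \<subseteq> Pow V" "S \<subseteq> V" "\<not> answer H S"
    and A0: "A0 \<in> H" "z \<in> A0" "z \<notin> S"
  obtains Q where "S \<subseteq> Q" "Q \<subseteq> V" "z \<notin> Q" "card V \<le> card Q + card H" "\<not> answer H Q"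
proof -
  have "\<forall>A\<in>H. \<exists>x. x \<in> A - S" using assms(4) unfolding answer_def by blast
  then obtain f where f: "\<And>A. A \<in> H \<Longrightarrow> f A \<in> A - S" by metis
  define t where "t = f(A0 := z)"
  have t: "t A \<in> A - S" if "A \<in> H" for A using f[OF that] A0 by (simp add: t_def)
  have finH: "finite H" using assms(1,2) by (auto intro: finite_subset)
  have sub: "t ` H \<subseteq> V" using t assms(2) by blast
  show ?thesis
  proof
    show "S \<subseteq> V - t ` H" using t assms(3) by blast
    show "V - t ` H \<subseteq> V" by blast
    show "z \<notin> V - t ` H" using A0 unfolding t_def by force
    have "card (V - t ` H) = card V - card (t ` H)" using card_Diff_subset[of "t ` H" V] finH sub by blast
    then show "card V \<le> card (V - t ` H) + card H" using card_image_le[OF finH, of t] by linarith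
    show "\<not> answer H (V - t ` H)" using t unfolding answer_def by blast
  qed
qed

lemma antichain_distinguished:
  assumes "finite V" "antichain_on V H" "antichain_on V H'" "card H = k" "card H' = k" "H \<noteq> H'" "2 \<le> k"
  shows "\<exists>Q. Q \<subset> V \<and> Q \<noteq> V - {b} \<and> card V \<le> card Q + k \<and> answer H Q \<noteq> answer H' Q"
proof (rule ccontr)
  assume neg: "\<not> ?thesis"
  \<comment> \<open>Extend \<open>S\<close> to a query omitting a prescribed point \<open>z\<close>
    of \<open>A - S\<close> on which \<open>H'\<close> still answers NO. \<open>H\<close> answers
    YES there, so the query must be the exempted \<open>V - {b}\<close>; hence \<open>z = b\<close>,
    and the NO of \<open>H'\<close> puts \<open>b\<close> into all its members.\<close>
  have step: "H' \<subseteq> Pow (insert b S) \<and> b \<notin> S \<and> (\<forall>A\<in>H'. b \<in> A)"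
    if HH: "antichain_on V H" "antichain_on V H'" "card H = k" "card H' = k"
      and S: "S \<in> H" "\<not> answer H' S"
      and eq: "\<And>Q. Q \<subset> V \<Longrightarrow> Q \<noteq> V - {b} \<Longrightarrow> card V \<le> card Q + k \<Longrightarrow> answer H Q = answer H' Q"
    for H H' S
  proof -
    have HP: "H' \<subseteq> Pow V" "S \<subseteq> V" "H' \<noteq> {}" using HH S assms(7) unfolding antichain_on_def by auto
    have z: "z = b" "\<forall>A\<in>H'. b \<in> A" if zA: "A \<in> H'" "z \<in> A" "z \<notin> S" for z A
    proof -
      obtain Q where Q: "S \<subseteq> Q" "Q \<subseteq> V" "z \<notin> Q" "card V \<le> card Q + card H'" "\<not> answer H' Q"
        using answer_no_extend[OF assms(1) HP(1,2) S(2) zA] by blast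
      have "answer H Q" using Q S unfolding answer_def by blast
      moreover have "Q \<subset> V" using Q that HP by blast
      ultimately have "Q = V - {b}" using eq[of Q] Q(4,5) HH(4) by auto
      then show "z = b" "\<forall>A\<in>H'. b \<in> A" using Q that HP unfolding answer_def by blast+
    qed
    obtain A where "A \<in> H'" using HP by blast
    then obtain y where "y \<in> A" "y \<notin> S" using S(2) unfolding answer_def by blast
    then show ?thesis using z \<open>A \<in> H'\<close> by blast
  qed
  have main: False
    if HH: "antichain_on V H" "antichain_on V H'" "card H = k" "card H' = k" "H \<noteq> H'"
      and S: "S \<in> H" "\<not> answer H' S"
      and eq: "\<And>Q. Q \<subset> V \<Longrightarrow> Q \<noteq> V - {b} \<Longrightarrow> card V \<le> card Q + k \<Longrightarrow> answer H Q = answer H' Q"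
    for H H' S
  proof -
    have st: "H' \<subseteq> Pow (insert b S)" "b \<notin> S" "\<And>A. A \<in> H' \<Longrightarrow> b \<in> A"
      using step[OF HH(1-4) S eq] by blast+
    \<comment> \<open>Otherwise \<open>step\<close> with the roles exchanged would give that
      \<open>b\<close> is not in \<open>A\<close>.\<close>
    have up: "answer H A" if "A \<in> H'" for A
      using step[OF HH(2,1,4,3) that, of] eq st(3)[OF that] by metis
    have "H' \<subseteq> H"
    proof
      fix A assume A: "A \<in> H'"
      obtain S1 where S1: "S1 \<in> H" "S1 \<subseteq> A" using up[OF A] unfolding answer_def by blast
      \<comment> \<open>Without \<open>b\<close>, \<open>S1\<close> would be \<open>S\<close> and
        \<open>A\<close> would be \<open>insert b S\<close>, which contains all of
        \<open>H'\<close>; then \<open>H'\<close> would have one member, against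
        \<open>2 \<le> k\<close>.\<close>
      have "b \<in> S1"
      proof (rule ccontr)
        assume "b \<notin> S1"
        then have "S1 \<subseteq> S" using S1 A st(1) by blast
        then have "S1 = S" using antichain_onD[OF HH(1) S1(1) S(1)] by blast
        then have "A = insert b S" using S1 A st by blast
        then have "B = A" if "B \<in> H'" for B
          using antichain_onD[OF HH(2) that A] st(1) that by blast
        then have "H' \<subseteq> {A}" by blast
        then have "card H' \<le> 1" using card_mono[of "{A}" H'] by simp
        then show False using HH assms(7) by simp
      qed
      \<comment> \<open>Contrapositive of \<open>step\<close>: a member of \<open>H\<close> on which
        \<open>H'\<close> answers NO cannot contain \<open>b\<close>.\<close>
      then have "answer H' S1" using step[OF HH(1-4) S1(1) _ eq] by blast
      then obtain A' where "A' \<in> H'" "A' \<subseteq> S1" unfolding answer_def by blast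
      then have "A' = A" using antichain_onD[OF HH(2) _ A, of A'] S1 by blast
      then show "A \<in> H" using S1 \<open>A' \<subseteq> S1\<close> by auto
    qed
    moreover have "finite H" using HH(3) assms(7) by (intro card_ge_0_finite) simp
    ultimately show False using HH card_subset_eq by metis
  qed
  show False
    using answer_antichain_inj[OF assms(2,3,6)] main[of H H'] main[of H' H] assms neg by metis
qed

text \<open>If the families agreed off \<open>{a}\<close> and \<open>V - {b}\<close>, they would
  agree on all queries avoiding \<open>a\<close>, so \<open>H'\<close> would arise from
  \<open>H\<close> by exchanging \<open>{a}\<close> for one set \<open>Z\<close>. Queries
  \<open>{a, x}\<close> then force \<open>H\<close> to consist of the singletons other than
  \<open>{z}\<close> for a point \<open>z\<close> of \<open>Z\<close>, too few for
  \<open>card V \<le> k\<close>.\<close>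

lemma antichain_distinguished_off_singleton:
  assumes "finite V" "antichain_on V H" "antichain_on V H'" "card H = k" "card H' = k" "card V \<le> k"
    and V: "4 \<le> card V" "a \<in> V" "b \<in> V" "a \<noteq> b" and ans: "answer H {a}" "\<not> answer H' {a}"
  shows "\<exists>Q. Q \<subseteq> V \<and> Q \<noteq> {a} \<and> Q \<noteq> V - {b} \<and> answer H Q \<noteq> answer H' Q"
proof (rule ccontr)
  assume "\<not> ?thesis"
  then have eq: "\<And>Q. Q \<subseteq> V \<Longrightarrow> Q \<noteq> {a} \<Longrightarrow> Q \<noteq> V - {b} \<Longrightarrow> answer H Q = answer H' Q" by blast
  have finH: "finite H" "finite H'" using assms(4-6) V(1) by (auto intro!: card_ge_0_finite)
  have ne: "{} \<notin> K" if "antichain_on V K" "card K = k" for K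
    using empty_notin_antichain[OF that(1)] that(2) assms(6) V(1) by simp
  have sub: "A \<subseteq> V" if "A \<in> H \<or> A \<in> H'" for A using that assms(2,3) unfolding antichain_on_def by blast
  obtain A0 where "A0 \<in> H" "A0 \<subseteq> {a}" using ans(1) unfolding answer_def by blast
  moreover have "A0 \<noteq> {}" using \<open>A0 \<in> H\<close> ne[OF assms(2,4)] by blast
  ultimately have aH: "{a} \<in> H" by (simp add: subset_singleton_iff)
  have anot: "a \<notin> S" if "S \<in> H" "S \<noteq> {a}" for S using antichain_onD[OF assms(2) aH that(1)] that by blast
  have sub': "H - {{a}} \<subseteq> H'"
  proof
    fix S assume S: "S \<in> H - {{a}}"
    have "answer H S" using S unfolding answer_def by blast
    moreover have "a \<notin> S" "S \<subseteq> V" using S anot sub by blast+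
    moreover have "S \<noteq> {a}" "S \<noteq> V - {b}" using \<open>a \<notin> S\<close> V(2,4) by blast+
    ultimately have "answer H' S" using eq[of S] by blast
    then obtain A where A: "A \<in> H'" "A \<subseteq> S" unfolding answer_def by blast
    have "a \<notin> A" "A \<subseteq> V" using A \<open>a \<notin> S\<close> sub by blast+
    moreover have "answer H' A" using A unfolding answer_def by blast
    moreover have "A \<noteq> {a}" "A \<noteq> V - {b}" using \<open>a \<notin> A\<close> V(2,4) by blast+
    ultimately have "answer H A" using eq[of A] by blast
    then obtain S1 where "S1 \<in> H" "S1 \<subseteq> A" unfolding answer_def by blast
    then have "S1 = S" using antichain_onD[OF assms(2), of S1 S] A S by blast
    then show "S \<in> H'" using A \<open>S1 \<subseteq> A\<close> by auto
  qed
  have "card (H' - (H - {{a}})) = 1"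
    using card_Diff_subset[OF _ sub'] finH assms aH by (simp add: card_gt_0_iff)
  then obtain Z where Z: "H' - (H - {{a}}) = {Z}" by (rule card_1_singletonE)
  have "Z \<noteq> {}" using Z ne[OF assms(3,5)] by blast
  moreover have "Z \<noteq> {a}" using Z ans(2) unfolding answer_def by blast
  ultimately obtain z where z: "z \<in> Z" "z \<noteq> a" by blast
  have ZH: "Z \<in> H'" using Z by blast
  have zV: "z \<in> V" using z ZH sub by blast
  have single: "{x} \<in> H" if "x \<in> V" "x \<noteq> z" for x
  proof (cases "x = a")
    case True
    then show ?thesis using aH by simp
  next
    case False
    \<comment> \<open>This is where \<open>4 \<le> card V\<close> enters: a complement of a
      singleton has at least three points.\<close>
    have "{a, x} \<noteq> V - {b}"
    proof
      assume "{a, x} = V - {b}"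
      then have "card {a, x} = card V - 1" using V assms(1) by simp
      then show False using V False by simp
    qed
    moreover have "answer H {a, x}" using aH unfolding answer_def by blast
    moreover have "{a, x} \<subseteq> V" "{a, x} \<noteq> {a}" using V(2) that(1) False by blast+
    ultimately have "answer H' {a, x}" using eq[of "{a, x}"] by blast
    then obtain A where A: "A \<in> H'" "A \<subseteq> {a, x}" unfolding answer_def by blast
    have "A \<noteq> Z" using A z that by blast
    then have "A \<notin> H' - (H - {{a}})" unfolding Z by simp
    then have "A \<in> H" "A \<noteq> {a}" using A(1) by simp_all
    then have "a \<notin> A" "A \<noteq> {}" using anot ne[OF assms(2,4)] by blast+
    then have "A = {x}" using A(2) by blast
    then show ?thesis using \<open>A \<in> H\<close> by simp
  qed
  have "{z} \<notin> H"
  proof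
    assume "{z} \<in> H"
    then have "{z} \<in> H'" "{z} \<in> H - {{a}}" using sub' z by blast+
    then have "Z = {z}" using antichain_onD[OF assms(3) _ ZH, of "{z}"] z by blast
    then show False using Z \<open>{z} \<in> H - {{a}}\<close> by blast
  qed
  have "H \<subseteq> (\<lambda>x. {x}) ` (V - {z})"
  proof
    fix S assume S: "S \<in> H"
    have "S \<noteq> {}" "S \<noteq> {z}" using S \<open>{z} \<notin> H\<close> ne[OF assms(2,4)] by blast+
    then obtain x where x: "x \<in> S" "x \<noteq> z" by blast
    then have "x \<in> V" using S sub by blast
    then have "{x} = S" using antichain_onD[OF assms(2) single[OF _ x(2)] S] x(1) by blast
    then show "S \<in> (\<lambda>x. {x}) ` (V - {z})" using x \<open>x \<in> V\<close> by blast
  qed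
  then have "card H \<le> card (V - {z})" using assms(1) by (intro surj_card_le) auto
  then show False using assms zV V by simp
qed

section \<open>The values of h in the three ranges\<close>

text \<open>Complements of singletons read off the points of the single member one by one.
  Conversely, a separating family gives distinct subfamilies of supersets to all
  \<open>2 ^ n\<close> sets, so \<open>2 ^ n \<le> 2 ^ card \<F>\<close>.\<close>

lemma h_one: "h n 1 = n"
proof (rule h_eqI)
  let ?f = "\<lambda>i. {1..n} - {i}"
  show "?f ` {1..n} \<subseteq> Pow {1..n}" by blast
  have "inj_on ?f {1..n}" by (intro inj_onI) blast
  then show "card (?f ` {1..n}) = n" by (simp add: card_image)
  show "separates_antichains n 1 (?f ` {1..n})"
    unfolding separates_antichains_def
  proof (intro allI impI)
    fix H H' assume H: "antichain_on {1..n} H \<and> antichain_on {1..n} H' \<and> card H = 1 \<and> card H' = 1 \<and> H \<noteq> H'"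
    then obtain S S' where S: "H = {S}" "H' = {S'}" by (metis card_1_singletonE)
    then have "S \<subseteq> {1..n}" "S' \<subseteq> {1..n}" "S \<noteq> S'" using H by (auto simp: antichain_on_def)
    then obtain i where "i \<in> {1..n}" "i \<in> S \<longleftrightarrow> i \<notin> S'" by blast
    then have "answer H (?f i) \<noteq> answer H' (?f i)"
      using S \<open>S \<subseteq> _\<close> \<open>S' \<subseteq> _\<close> unfolding answer_def by auto
    then show "\<exists>G\<in>?f ` {1..n}. answer H G \<noteq> answer H' G" using \<open>i \<in> _\<close> by blast
  qed
next
  fix \<F> assume F: "\<F> \<subseteq> Pow {1..n}" "separates_antichains n 1 \<F>"
  have "inj_on (\<lambda>S. {G \<in> \<F>. S \<subseteq> G}) (Pow {1..n})"
  proof (rule inj_onI, rule ccontr)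
    fix S S' assume S: "S \<in> Pow {1..n}" "S' \<in> Pow {1..n}" "{G \<in> \<F>. S \<subseteq> G} = {G \<in> \<F>. S' \<subseteq> G}" "S \<noteq> S'"
    have "antichain_on {1..n} {S}" "antichain_on {1..n} {S'}" using S antichain_on_singleton by blast+
    then have "\<exists>G\<in>\<F>. answer {S} G \<noteq> answer {S'} G"
      using F(2) S(4) unfolding separates_antichains_def by simp
    then show False using S(3) unfolding answer_def by blast
  qed
  moreover have "finite \<F>" using F(1) by (rule finite_subset) simp
  ultimately have "card (Pow {1..n}) \<le> card (Pow \<F>)" by (intro card_inj_on_le) auto
  then show "n \<le> card \<F>" using \<open>finite \<F>\<close> by (simp add: card_Pow)
qed

lemma card_le_Suc_0_if_all_eq: "(\<And>x y. x \<in> A \<Longrightarrow> y \<in> A \<Longrightarrow> x = y) \<Longrightarrow> card A \<le> 1"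
  by (cases "finite A") (auto simp: card_le_Suc0_iff_eq)

lemma card_eq_minus_1E:
  assumes "finite V" "Q \<subseteq> V" "Suc (card Q) = card V"
  obtains i where "i \<in> V" "Q = V - {i}"
proof -
  have "card (V - Q) = 1" using card_Diff_subset[of Q V] assms finite_subset by fastforce
  then obtain i where "V - Q = {i}" by (rule card_1_singletonE)
  then show ?thesis using that[of i] assms by blast
qed

lemma missing_cosingletons:
  assumes sep: "\<F> \<subseteq> Pow {1..n}" "separates_antichains n k \<F>"
    and T: "\<And>i j. i \<in> {1..n} \<Longrightarrow> j \<in> {1..n} \<Longrightarrow> i \<noteq> j \<Longrightarrow>
      \<exists>T. antichain_on ({1..n} - {i, j}) T \<and> {1..n} - {i, j} \<notin> T \<and> card T + 1 = k"
  shows "card ({Q. Q \<subseteq> {1..n} \<and> Suc (card Q) = n} - \<F>) \<le> 1"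
proof (rule card_le_Suc_0_if_all_eq, rule ccontr)
  fix Q Q' assume Q: "Q \<in> {Q. Q \<subseteq> {1..n} \<and> Suc (card Q) = n} - \<F>"
    and Q': "Q' \<in> {Q. Q \<subseteq> {1..n} \<and> Suc (card Q) = n} - \<F>" and ne: "Q \<noteq> Q'"
  obtain i where i: "i \<in> {1..n}" "Q = {1..n} - {i}" using Q card_eq_minus_1E[of "{1..n}" Q] by auto
  obtain j where j: "j \<in> {1..n}" "Q' = {1..n} - {j}" using Q' card_eq_minus_1E[of "{1..n}" Q'] by auto
  have "i \<noteq> j" using i j ne by blast
  then obtain T where "antichain_on ({1..n} - {i, j}) T" "{1..n} - {i, j} \<notin> T" "card T + 1 = k"
    using T i j by blast
  then have "critical_pair {1..n} k {Q, Q'}"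
    using critical_pair_cosingletons[of "{1..n}" i j T k] i j \<open>i \<noteq> j\<close> by simp
  then show False using separates_meets_critical_pair[OF sep(2,1)] Q Q' by blast
qed

lemma card_levels:
  assumes "finite V"
  shows "card {Q. Q \<subseteq> V \<and> a \<le> card Q \<and> card Q \<le> b} = (\<Sum>i=a..b. card V choose i)"
proof -
  have "{Q. Q \<subseteq> V \<and> a \<le> card Q \<and> card Q \<le> b} = (\<Union>i\<in>{a..b}. {Q. Q \<subseteq> V \<and> card Q = i})" by auto
  also have "card \<dots> = (\<Sum>i=a..b. card {Q. Q \<subseteq> V \<and> card Q = i})"
    by (rule card_UN_disjoint) (use assms in auto)
  finally show ?thesis using n_subsets[OF assms] by simp
qed

lemma h_few:
  assumes "3 \<le> n" "1 < k" "k < n"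
  shows "h n k = (\<Sum>i=n-k..n-1. n choose i) - 1"
proof -
  define N where "N = {Q. Q \<subseteq> {1..n} \<and> n - k \<le> card Q \<and> card Q \<le> n - 1}"
  have finN: "finite N" by (rule finite_subset[of _ "Pow {1..n}"]) (auto simp: N_def)
  have cardN: "card N = (\<Sum>i=n-k..n-1. n choose i)" unfolding N_def using card_levels[of "{1..n}"] by simp
  show ?thesis unfolding cardN[symmetric]
  proof (rule h_eqI)
    show "N - {{1..n} - {1}} \<subseteq> Pow {1..n}" by (auto simp: N_def)
    have "{1..n} - {1} \<in> N" using assms by (auto simp: N_def)
    then show "card (N - {{1..n} - {1}}) = card N - 1" using finN by simp
    show "separates_antichains n k (N - {{1..n} - {1}})"
      unfolding separates_antichains_def
    proof (intro allI impI)
      fix H H' assume "antichain_on {1..n} H \<and> antichain_on {1..n} H' \<and> card H = k \<and> card H' = k \<and> H \<noteq> H'"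
      then obtain Q where Q: "Q \<subset> {1..n}" "Q \<noteq> {1..n} - {1}" "n \<le> card Q + k" "answer H Q \<noteq> answer H' Q"
        using antichain_distinguished[of "{1..n}" H H' k 1] assms by auto
      have "card Q < n" using psubset_card_mono[OF _ Q(1)] by simp
      then have "Q \<in> N - {{1..n} - {1}}" using Q by (auto simp: N_def)
      then show "\<exists>G\<in>N - {{1..n} - {1}}. answer H G \<noteq> answer H' G" using Q by blast
    qed
  next
    fix \<F> assume F: "\<F> \<subseteq> Pow {1..n}" "separates_antichains n k \<F>"
    have "N - \<F> \<subseteq> {Q. Q \<subseteq> {1..n} \<and> Suc (card Q) = n} - \<F>"
    proof
      fix G assume G: "G \<in> N - \<F>"
      have "Suc (card G) = n"
      proof (rule ccontr)
        assume "Suc (card G) \<noteq> n"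
        then have "critical_pair {1..n} k {G}"
          using G assms by (intro critical_pair_few) (auto simp: N_def)
        then show False using separates_meets_critical_pair[OF F(2,1)] G by blast
      qed
      then show "G \<in> {Q. Q \<subseteq> {1..n} \<and> Suc (card Q) = n} - \<F>" using G by (auto simp: N_def)
    qed
    then have "card (N - \<F>) \<le> card ({Q. Q \<subseteq> {1..n} \<and> Suc (card Q) = n} - \<F>)"
      by (intro card_mono) auto
    also have "\<dots> \<le> 1"
    proof (rule missing_cosingletons[OF F])
      fix i j assume ij: "i \<in> {1..n}" "j \<in> {1..n}" "i \<noteq> j"
      obtain T where "antichain_on ({1..n} - {i, j}) T" "card T = k - 1" "{1..n} - {i, j} \<notin> T"
        by (rule small_antichain_exists[of "{1..n} - {i, j}" "k - 1"]) (use card_Diff_pair[OF finite_atLeastAtMost ij] assms in auto)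
      then show "\<exists>T. antichain_on ({1..n} - {i, j}) T \<and> {1..n} - {i, j} \<notin> T \<and> card T + 1 = k" 
        using assms by auto
    qed
    finally have 1: "card (N - \<F>) \<le> 1" .
    have "finite \<F>" using F(1) by (rule finite_subset) simp
    then have "card N \<le> card \<F> + card (N - \<F>)"
      using card_mono[of "\<F> \<union> (N - \<F>)" N] card_Un_le[of \<F> "N - \<F>"] finN by fastforce
    then show "card N - 1 \<le> card \<F>" using 1 by simp
  qed
qed

lemma h_many:
  assumes "3 \<le> n" "n \<le> k" "k \<le> ((n - 2) choose (n div 2 - 1)) + 1"
  shows "h n k = 2 ^ n - 4"
proof -
  define m where "m = n div 2 - 1"
  \<comment> \<open>For these \<open>n\<close> the binomial bound gives 2, 3 and 4, so no
    \<open>k \<ge> n\<close> satisfies it.\<close>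
  have "n \<noteq> 3" "n \<noteq> 4" "n \<noteq> 5" using assms by auto
  then have n6: "6 \<le> n" using assms by simp
  \<comment> \<open>\<open>2 \<le> m\<close> makes \<open>m\<close>-sets admissible in
    \<open>critical_pair_singletons\<close>; \<open>m < n - 2\<close> keeps
    \<open>{1..n} - {i, j}\<close> out of families of \<open>m\<close>-sets.\<close>
  then have m: "2 \<le> m" "m < n - 2" by (auto simp: m_def)
  have km: "k \<le> ((n - 2) choose m) + 1" using assms by (simp add: m_def)
  define N where "N = Pow {1..n} - {{}, {1..n}}"
  have finN: "finite N" by (simp add: N_def)
  have "card (Pow {1..n} - {{}, {1..n}}) = card (Pow {1..n}) - card {{}, {1..n}}"
    by (rule card_Diff_subset) auto
  then have cardN: "card N = 2 ^ n - 2" using n6 by (simp add: N_def card_Pow)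
  have uniform: "\<exists>T. antichain_on ({1..n} - {i, j}) T \<and> card T = r \<and> (\<forall>A\<in>T. card A = m)"
    if "i \<in> {1..n}" "j \<in> {1..n}" "i \<noteq> j" "r \<le> k - 1" for i j r
  proof -
    have "card ({1..n} - {i, j}) = n - 2" using card_Diff_pair[OF finite_atLeastAtMost that(1-3)] by simp
    then have "card {B. B \<subseteq> {1..n} - {i, j} \<and> card B = m} = (n - 2) choose m"
      using n_subsets[of "{1..n} - {i, j}" m] by simp
    then have "r \<le> card {B. B \<subseteq> {1..n} - {i, j} \<and> card B = m}" using that km by simp
    then obtain T where T: "T \<subseteq> {B. B \<subseteq> {1..n} - {i, j} \<and> card B = m}" "card T = r"
      by (rule obtain_subset_with_card_n)
    then show ?thesis using antichain_on_uniform[OF T(1)] by blast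
  qed
  have two: "{1::nat} \<noteq> {1..n} - {2}"
  proof
    assume "{1::nat} = {1..n} - {2}"
    moreover have "3 \<in> {1..n} - {2}" using n6 by simp
    ultimately have "(3::nat) \<in> {1}" by (simp only:)
    then show False by simp
  qed
  show ?thesis
  proof (rule h_eqI)
    \<comment> \<open>The two omitted sets use different points: the argument for omitting
      \<open>{1}\<close> relies on queries avoiding 1, so \<open>{1..n} - {1}\<close> has to remain
      available.\<close>
    let ?G = "N - {{1}, {1..n} - {2}}"
    show "?G \<subseteq> Pow {1..n}" by (auto simp: N_def)
    have "1 \<in> {1..n} - {2}" "2 \<in> {1..n} - {1}" using n6 by simp_all
    then have "{{1}, {1..n} - {2}} \<subseteq> N" unfolding N_def by blast
    then show "card ?G = 2 ^ n - 4" using card_Diff_subset[of "{{1}, {1..n} - {2}}" N] two cardN by simp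
    show "separates_antichains n k ?G"
      unfolding separates_antichains_def
    proof (intro allI impI)
      fix H H' assume H: "antichain_on {1..n} H \<and> antichain_on {1..n} H' \<and> card H = k \<and> card H' = k \<and> H \<noteq> H'"
      have triv: "Q \<noteq> {}" "Q \<noteq> {1..n}" if "answer H Q \<noteq> answer H' Q" for Q
      proof -
        have "\<not> answer K {} \<and> answer K {1..n}" if K: "antichain_on {1..n} K" "card K = k" for K
        proof -
          have "{} \<notin> K" using empty_notin_antichain[OF K(1)] K(2) n6 assms(2) by simp
          moreover have "K \<noteq> {}" "K \<subseteq> Pow {1..n}" using K n6 assms unfolding antichain_on_def by auto
          ultimately show ?thesis unfolding answer_def by auto
        qed
        then show "Q \<noteq> {}" "Q \<noteq> {1..n}" using that H by metis+
      qed
      obtain Q where Q: "Q \<subset> {1..n}" "Q \<noteq> {1..n} - {2}" "answer H Q \<noteq> answer H' Q"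
        using antichain_distinguished[of "{1..n}" H H' k 2] assms H by auto
      have "\<exists>Q. Q \<subseteq> {1..n} \<and> Q \<noteq> {1} \<and> Q \<noteq> {1..n} - {2} \<and> answer H Q \<noteq> answer H' Q"
      proof (cases "Q = {1}")
        case True
        then show ?thesis
          using antichain_distinguished_off_singleton[of "{1..n}" H H' k 1 2]
            antichain_distinguished_off_singleton[of "{1..n}" H' H k 1 2] Q(3) H assms n6
          by (cases "answer H {1}") auto
      next
        case False
        then show ?thesis using Q by blast
      qed
      then show "\<exists>G\<in>?G. answer H G \<noteq> answer H' G" using triv unfolding N_def by blast
    qed
  next
    fix \<F> assume F: "\<F> \<subseteq> Pow {1..n}" "separates_antichains n k \<F>"
    let ?C = "{Q. Q \<subseteq> {1..n} \<and> Suc (card Q) = n} - \<F>"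
    let ?S = "{Q. Q \<subseteq> {1..n} \<and> card Q = 1} - \<F>"
    have sub: "N - \<F> \<subseteq> ?C \<union> ?S"
    proof
      fix G assume G: "G \<in> N - \<F>"
      have fG: "G \<subseteq> {1..n}" "finite G" using G finite_subset[of G "{1..n}"] by (auto simp: N_def)
      have "G \<subset> {1..n}" using G by (auto simp: N_def)
      then have "card G < n" using psubset_card_mono[of "{1..n}" G] by simp
      moreover have "card G > 0" using G fG by (auto simp: N_def card_gt_0_iff)
      moreover have "Suc (card G) = n \<or> card G = 1"
      proof (rule ccontr)
        assume "\<not> ?thesis"
        then have "critical_pair {1..n} k {G}"
          using fG \<open>card G < n\<close> \<open>card G > 0\<close> assms km by (intro critical_pair_many[where m = m]) auto
        then show False using separates_meets_critical_pair[OF F(2,1)] G by blast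
      qed
      ultimately show "G \<in> ?C \<union> ?S" using G fG by blast
    qed
    have C: "card ?C \<le> 1"
    proof (rule missing_cosingletons[OF F])
      fix i j assume ij: "i \<in> {1..n}" "j \<in> {1..n}" "i \<noteq> j"
      obtain T where T: "antichain_on ({1..n} - {i, j}) T" "card T = k - 1" "\<forall>A\<in>T. card A = m"
        using uniform[OF ij order_refl] by blast
      then have "{1..n} - {i, j} \<notin> T" using card_Diff_pair[OF finite_atLeastAtMost ij] m by auto
      then show "\<exists>T. antichain_on ({1..n} - {i, j}) T \<and> {1..n} - {i, j} \<notin> T \<and> card T + 1 = k"
        using T assms by auto
    qed
    have S: "card ?S \<le> 1"
    proof (rule card_le_Suc_0_if_all_eq, rule ccontr)
      fix A B assume A: "A \<in> ?S" and B: "B \<in> ?S" and ne: "A \<noteq> B"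
      obtain a b where ab: "A = {a}" "B = {b}" using A B by (auto simp: card_1_singleton_iff)
      have ij: "a \<in> {1..n}" "b \<in> {1..n}" "a \<noteq> b" using A B ab ne by auto
      \<comment> \<open>The size \<open>k + 1 - n\<close> is what
        \<open>critical_pair_singletons\<close> requires of \<open>F\<close>.\<close>
      have "k + 1 - n \<le> k - 1" using n6 assms by simp
      then obtain T where T: "antichain_on ({1..n} - {a, b}) T" "card T = k + 1 - n" "\<forall>A\<in>T. card A = m"
        using uniform[OF ij] by blast
      then have "critical_pair {1..n} k {{a}, {b}}"
        using ij m assms by (intro critical_pair_singletons[where F = T]) auto
      then show False using separates_meets_critical_pair[OF F(2,1)] A B ab by blast
    qed
    have "card (N - \<F>) \<le> card (?C \<union> ?S)" by (rule card_mono[OF _ sub]) auto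
    also have "\<dots> \<le> 2" using card_Un_le[of ?C ?S] C S by linarith
    finally have 2: "card (N - \<F>) \<le> 2" .
    have "finite \<F>" using F(1) by (rule finite_subset) simp
    then have "card N \<le> card \<F> + card (N - \<F>)"
      using card_mono[of "\<F> \<union> (N - \<F>)" N] card_Un_le[of \<F> "N - \<F>"] finN by fastforce
    then show "2 ^ n - 4 \<le> card \<F>" using 2 cardN by simp
  qed
qed

theorem theorem1p2:
  fixes n k :: nat
  assumes "n \<ge> 3"
  shows "(k = 1 \<longrightarrow> h n k = n)
    \<and> (1 < k \<and> k < n \<longrightarrow> h n k = (\<Sum>i=n-k..n-1. n choose i) - 1)
    \<and> (n \<le> k \<and> k \<le> ((n - 2) choose (n div 2 - 1)) + 1 \<longrightarrow> h n k = 2 ^ n - 4)"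
  using h_one h_few[OF assms] h_many[OF assms] by blast

end
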